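(* Let $(A,M,\{P_x\}_{x\in X})$ be a matching relative Rota-Baxter algebra. Then the infinitesimal $(\mu_1,\beta_1,P_1)$ of any formal one-parameter deformation of $(A,M,\{P_x\}_{x\in X})$ is a 2-cocycle in $\{C^\bullet_{\mathrm{mrRBA}}(A,M,\{P_x\}_{x\in X}),\delta_{\mathrm{mrRBA}}\}$. Moreover, the corresponding cohomology class in $H^2_{\mathrm{mrRBA}}(A,M,\{P_x\}_{x\in X})$ depends only on the equivalence class of the deformation.
   Context: $\mathbb K$ is a commutative unital ring with $\mathrm{char}\,\mathbb K\neq 2$; all modules, linear maps, Hom spaces and tensor products are over $\mathbb K$ unless specified; $X$ is a nonempty set. $\mu(a,b)=a\cdot b$ denotes the product of $A$, and $l(a,u)=l_M(a,u)=a\cdot_M u$, $r(u,a)=r_M(u,a)=u\cdot_M a$ the left and right actions on the $A$-bimodule $M$. A matching relative Rota-Baxter algebra is a triple $(A,M,\{P_x\}_{x\in X})$ of an associative algebra $A$, an $A$-bimodule $M$ and linear maps $P_x:M\to A$ such that $P_x(u)\cdot P_y(v)=P_x(u\cdot_M P_y(v))+P_y(P_x(u)\cdot_M v)$ for all $u,v\in M$, $x,y\in X$. A morphism $(A,M,\{P_x\})\to(A',M',\{P'_x\})$ is a pair $(\varphi,\psi)$ of an algebra homomorphism $\varphi:A\to A'$ and a linear map $\psi:M\to M'$ with $\psi(a\cdot_Mu)=\varphi(a)\cdot_{M'}\psi(u)$, $\psi(u\cdot_Ma)=\psi(u)\cdot_{M'}\varphi(a)$ and $\varphi\circ P_x=P'_x\circ\psi$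 for all $a,u,x$. A formal one-parameter deformation of $(A,M,\{P_x\})$ is a tuple $(\mu_t,l_t,r_t,\{(P_t)_x\}_{x\in X})$ of formal power series $\mu_t=\sum_{i\ge0}t^i\mu_i$, $l_t=\sum t^il_i$, $r_t=\sum t^ir_i$, $(P_t)_x=\sum t^iP_{i,x}$, with $\mu_i\in\mathrm{Hom}(A^{\otimes2},A)$, $l_i\in\mathrm{Hom}(A\otimes M,M)$, $r_i\in\mathrm{Hom}(M\otimes A,M)$, $P_{i,x}\in\mathrm{Hom}(M,A)$ and $\mu_0=\mu$, $l_0=l$, $r_0=r$, $P_{0,x}=P_x$, such that (with $\mathbb K[[t]]$-linear extension) $((A[[t]],\mu_t),(M[[t]],l_t,r_t),\{(P_t)_x\}_{x\in X})$ is a matching relative Rota-Baxter algebra over $\mathbb K[[t]]$. Two such deformations $(\mu_t,l_t,r_t,\{(P_t)_x\})$, $(\mu'_t,l'_t,r'_t,\{(P'_t)_x\})$ are equivalent if there are formal isomorphisms $\varphi_t=\sum t^i\varphi_i:A[[t]]\to A[[t]]$, $\psi_t=\sum t^i\psi_i:M[[t]]\to M[[t]]$ ($\varphi_i\in\mathrm{Hom}(A,A)$, $\psi_i\in\mathrm{Hom}(M,M)$, $\varphi_0=\mathrm{id}_A$, $\psi_0=\mathrm{id}_M$) such that $(\varphi_t,\psi_t)$ is a morphism of matching relative Rota-Baxter algebras from the first deformed structure to the second. The infinitesimal of a deformation is $(\mu_1,\beta_1,P_1)\in C^2_{\mathrm{mrRBA}}$, where $\beta_1\in\mathrm{Hom}(\mathcal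 A^{1,1},M)$ is $\beta_1(a,u)=l_1(a,u)$, $\beta_1(u,a)=r_1(u,a)$, and $P_1=\oplus_{x\in X}P_{1,x}$. The complex: $\mathcal A^{n-1,1}$ is the direct sum of all $n$-fold tensor products of $A$ and $M$ in which $A$ appears $n-1$ times and $M$ exactly once. $C^n_{\{P_x\}}(M,A)$ is, for $n\ge1$, the $\mathbb K$-module of all families $f=\oplus f_{x_1,\dots,x_n}$, $f_{x_1,\dots,x_n}\in\mathrm{Hom}(M^{\otimes n},A)$, indexed by $X^{\times n}$, with $$(\delta_{\{P_x\}}f)_{x_1,\dots,x_{n+1}}(u_1,\dots,u_{n+1})=P_{x_1}(u_1)\cdot f_{x_2,\dots,x_{n+1}}(u_2,\dots,u_{n+1})-P_{x_1}(u_1\cdot_M f_{x_2,\dots,x_{n+1}}(u_2,\dots,u_{n+1}))$$ $$+\sum_{i=1}^n(-1)^i f_{x_1,\dots,x_i,x_{i+2},\dots,x_{n+1}}(u_1,\dots,u_{i-1},u_i\cdot_M P_{x_{i+1}}(u_{i+1}),\dots,u_{n+1})$$ $$+\sum_{i=1}^n(-1)^i f_{x_1,\dots,x_{i-1},x_{i+1},\dots,x_{n+1}}(u_1,\dots,u_{i-1},P_{x_i}(u_i)\cdot_M u_{i+1},\dots,u_{n+1})$$ $$+(-1)^{n+1}f_{x_1,\dots,x_n}(u_1,\dots,u_n)\cdot P_{x_{n+1}}(u_{n+1})-(-1)^{n+1}P_{x_{n+1}}(f_{x_1,\dots,x_n}(u_1,\dots,u_n)\cdot_M u_{n+1}).$$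 $C^0_{\mathrm{mrRBA}}=0$, $C^1_{\mathrm{mrRBA}}=\mathrm{Hom}(A,A)\oplus\mathrm{Hom}(M,M)$, and for $n\ge2$, $C^n_{\mathrm{mrRBA}}=\mathrm{Hom}(A^{\otimes n},A)\oplus\mathrm{Hom}(\mathcal A^{n-1,1},M)\oplus C^{n-1}_{\{P_x\}}(M,A)$. $\delta_{\mathrm{Hoch}}$ is the Hochschild coboundary of $A$ with coefficients in $A$: $\delta_{\mathrm{Hoch}}(f)(a_1,\dots,a_{n+1})=a_1\cdot f(a_2,\dots,a_{n+1})+\sum_{i=1}^n(-1)^if(a_1,\dots,a_i\cdot a_{i+1},\dots,a_{n+1})+(-1)^{n+1}f(a_1,\dots,a_n)\cdot a_{n+1}$. For $\alpha\in\mathrm{Hom}(A^{\otimes n},A)$, $\beta\in\mathrm{Hom}(\mathcal A^{n-1,1},M)$, $$\delta^\alpha_{\mathrm{Hoch}}(\beta)(a_1,\dots,a_{n+1})=(l_M+r_M)(a_1,(\alpha+\beta)(a_2,\dots,a_{n+1}))+\sum_{i=1}^n(-1)^i\beta(a_1,\dots,(\mu+l_M+r_M)(a_i,a_{i+1}),\dots,a_{n+1})+(-1)^{n+1}(l_M+r_M)((\alpha+\beta)(a_1,\dots,a_n),a_{n+1}),$$ where exactly one $a_j$ lies in $M$ and the others in $A$, and in each sum of maps one applies the unique summand whose domain matches the arguments. Also $$(h_{\{P_x\}}(\alpha,\beta))_{x_1,\dots,x_n}(u_1,\dots,u_n)=(-1)^n\Big\{\alpha(P_{x_1}(u_1),\dots,P_{x_n}(u_n))-\sum_{i=1}^nP_{x_i}\beta(P_{x_1}(u_1),\dots,u_i,\dots,P_{x_n}(u_n))\Big\}.$$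 $\delta_{\mathrm{mrRBA}}(\alpha,\beta)=(\delta_{\mathrm{Hoch}}(\alpha),\delta^\alpha_{\mathrm{Hoch}}(\beta),h_{\{P_x\}}(\alpha,\beta))$ on $C^1_{\mathrm{mrRBA}}$, and $\delta_{\mathrm{mrRBA}}(\alpha,\beta,\gamma)=(\delta_{\mathrm{Hoch}}(\alpha),\delta^\alpha_{\mathrm{Hoch}}(\beta),\delta_{\{P_x\}}(\gamma)+h_{\{P_x\}}(\alpha,\beta))$ on $C^n_{\mathrm{mrRBA}}$, $n\ge2$. $H^n_{\mathrm{mrRBA}}$ denotes the cohomology of this cochain complex. *)

theory Defs
  imports
    "HOL-Computational_Algebra.Computational_Algebra"
    "HOL-Library.Function_Algebras"
    "HOL-Library.Product_Plus"
begin

section \<open>Matching relative Rota-Baxter algebras\<close>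

text \<open>
  Modules over a commutative ring \<open>'k\<close> are types \<open>'a\<close> of class \<open>ab_group_add\<close> with a scalar
  multiplication \<open>'k \<Rightarrow> 'a \<Rightarrow> 'a\<close> satisfying \<^locale>\<open>module\<close>. The nonempty index set \<open>X\<close> is
  the type \<open>'x\<close>. Elements of \<open>Hom (V \<otimes> W, U)\<close> are bilinear maps, and elements of
  \<open>Hom (V\<^sub>1 \<otimes> \<dots> \<otimes> V\<^sub>n, U)\<close> are multilinear maps.
\<close>

record ('a, 'm, 'x) mrrb_ops =
  mul :: "'a \<Rightarrow> 'a \<Rightarrow> 'a"
  lact :: "'a \<Rightarrow> 'm \<Rightarrow> 'm"
  ract :: "'m \<Rightarrow> 'a \<Rightarrow> 'm"
  rb :: "'x \<Rightarrow> 'm \<Rightarrow> 'a"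

definition module_bilinear ::
  "('k::comm_ring_1 \<Rightarrow> 'a::ab_group_add \<Rightarrow> 'a) \<Rightarrow> ('k \<Rightarrow> 'b::ab_group_add \<Rightarrow> 'b) \<Rightarrow>
   ('k \<Rightarrow> 'c::ab_group_add \<Rightarrow> 'c) \<Rightarrow> ('a \<Rightarrow> 'b \<Rightarrow> 'c) \<Rightarrow> bool" where
  "module_bilinear s1 s2 s3 f \<longleftrightarrow>
     (\<forall>x. module_hom s2 s3 (\<lambda>y. f x y)) \<and> (\<forall>y. module_hom s1 s3 (\<lambda>x. f x y))"

definition associative_algebra ::
  "('k::comm_ring_1 \<Rightarrow> 'a::ab_group_add \<Rightarrow> 'a) \<Rightarrow> ('a \<Rightarrow> 'a \<Rightarrow> 'a) \<Rightarrow> bool" where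
  "associative_algebra s m \<longleftrightarrow>
     module s \<and> module_bilinear s s s m \<and> (\<forall>a b c. m (m a b) c = m a (m b c))"

definition algebra_bimodule ::
  "('k::comm_ring_1 \<Rightarrow> 'a::ab_group_add \<Rightarrow> 'a) \<Rightarrow> ('k \<Rightarrow> 'm::ab_group_add \<Rightarrow> 'm) \<Rightarrow>
   ('a \<Rightarrow> 'a \<Rightarrow> 'a) \<Rightarrow> ('a \<Rightarrow> 'm \<Rightarrow> 'm) \<Rightarrow> ('m \<Rightarrow> 'a \<Rightarrow> 'm) \<Rightarrow> bool" where
  "algebra_bimodule sA sM m l r \<longleftrightarrow>
     module sM \<and> module_bilinear sA sM sM l \<and> module_bilinear sM sA sM r \<and>
     (\<forall>a b u. l (m a b) u = l a (l b u)) \<and>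
     (\<forall>a b u. r u (m a b) = r (r u a) b) \<and>
     (\<forall>a b u. r (l a u) b = l a (r u b))"

definition matching_rel_RB_algebra ::
  "('k::comm_ring_1 \<Rightarrow> 'a::ab_group_add \<Rightarrow> 'a) \<Rightarrow> ('k \<Rightarrow> 'm::ab_group_add \<Rightarrow> 'm) \<Rightarrow>
   ('a, 'm, 'x) mrrb_ops \<Rightarrow> bool" where
  "matching_rel_RB_algebra sA sM S \<longleftrightarrow>
     associative_algebra sA (mul S) \<and>
     algebra_bimodule sA sM (mul S) (lact S) (ract S) \<and>
     (\<forall>x. module_hom sM sA (rb S x)) \<and>
     (\<forall>x y u v. mul S (rb S x u) (rb S y v) =
        rb S x (ract S u (rb S y v)) + rb S y (lact S (rb S x u) v))"

definition mrrb_morphism ::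
  "('k::comm_ring_1 \<Rightarrow> 'a::ab_group_add \<Rightarrow> 'a) \<Rightarrow> ('k \<Rightarrow> 'm::ab_group_add \<Rightarrow> 'm) \<Rightarrow>
   ('a, 'm, 'x) mrrb_ops \<Rightarrow>
   ('k \<Rightarrow> 'b::ab_group_add \<Rightarrow> 'b) \<Rightarrow> ('k \<Rightarrow> 'n::ab_group_add \<Rightarrow> 'n) \<Rightarrow>
   ('b, 'n, 'x) mrrb_ops \<Rightarrow> ('a \<Rightarrow> 'b) \<Rightarrow> ('m \<Rightarrow> 'n) \<Rightarrow> bool" where
  "mrrb_morphism sA sM S sA' sM' S' \<phi> \<psi> \<longleftrightarrow>
     module_hom sA sA' \<phi> \<and> (\<forall>a b. \<phi> (mul S a b) = mul S' (\<phi> a) (\<phi> b)) \<and>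
     module_hom sM sM' \<psi> \<and>
     (\<forall>a u. \<psi> (lact S a u) = lact S' (\<phi> a) (\<psi> u)) \<and>
     (\<forall>u a. \<psi> (ract S u a) = ract S' (\<psi> u) (\<phi> a)) \<and>
     (\<forall>x u. \<phi> (rb S x u) = rb S' x (\<psi> u))"

section \<open>Formal one-parameter deformations\<close>

text \<open>
  \<open>A[[t]]\<close> is the type \<open>'a fps\<close>, a module over \<open>'k fps\<close>. A family \<open>(f\<^sub>i)\<close> of (bi)linear maps
  stands for \<open>\<Sum>\<^sub>i t\<^sup>i f\<^sub>i\<close>, extended \<open>K[[t]]\<close>-(bi)linearly to power series.
\<close>

definition fps_scale ::
  "('k::comm_ring_1 \<Rightarrow> 'a::ab_group_add \<Rightarrow> 'a) \<Rightarrow> 'k fps \<Rightarrow> 'a fps \<Rightarrow> 'a fps" where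
  "fps_scale s c f = Abs_fps (\<lambda>n. \<Sum>i\<le>n. s (fps_nth c i) (fps_nth f (n - i)))"

definition fps_linear_ext ::
  "(nat \<Rightarrow> 'a::ab_group_add \<Rightarrow> 'b::ab_group_add) \<Rightarrow> 'a fps \<Rightarrow> 'b fps" where
  "fps_linear_ext p f = Abs_fps (\<lambda>n. \<Sum>i\<le>n. p i (fps_nth f (n - i)))"

definition fps_bilinear_ext ::
  "(nat \<Rightarrow> 'a::ab_group_add \<Rightarrow> 'b::ab_group_add \<Rightarrow> 'c::ab_group_add) \<Rightarrow>
   'a fps \<Rightarrow> 'b fps \<Rightarrow> 'c fps" where
  "fps_bilinear_ext p f g =
     Abs_fps (\<lambda>n. \<Sum>i\<le>n. \<Sum>j\<le>n - i. p i (fps_nth f j) (fps_nth g (n - i - j)))"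

definition fps_ops ::
  "(nat \<Rightarrow> ('a::ab_group_add, 'm::ab_group_add, 'x) mrrb_ops) \<Rightarrow>
   ('a fps, 'm fps, 'x) mrrb_ops" where
  "fps_ops D =
     \<lparr> mul = fps_bilinear_ext (\<lambda>i. mul (D i)),
       lact = fps_bilinear_ext (\<lambda>i. lact (D i)),
       ract = fps_bilinear_ext (\<lambda>i. ract (D i)),
       rb = (\<lambda>x. fps_linear_ext (\<lambda>i. rb (D i) x)) \<rparr>"

text \<open>\<open>D i\<close> collects the coefficients \<open>(\<mu>\<^sub>i, l\<^sub>i, r\<^sub>i, {P\<^sub>i\<^sub>,\<^sub>x}\<^sub>x)\<close> of \<open>t\<^sup>i\<close>.\<close>

definition formal_deformation ::
  "('k::comm_ring_1 \<Rightarrow> 'a::ab_group_add \<Rightarrow> 'a) \<Rightarrow> ('k \<Rightarrow> 'm::ab_group_add \<Rightarrow> 'm) \<Rightarrow>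
   ('a, 'm, 'x) mrrb_ops \<Rightarrow> (nat \<Rightarrow> ('a, 'm, 'x) mrrb_ops) \<Rightarrow> bool" where
  "formal_deformation sA sM S D \<longleftrightarrow>
     D 0 = S \<and>
     (\<forall>i. module_bilinear sA sA sA (mul (D i)) \<and>
          module_bilinear sA sM sM (lact (D i)) \<and>
          module_bilinear sM sA sM (ract (D i)) \<and>
          (\<forall>x. module_hom sM sA (rb (D i) x))) \<and>
     matching_rel_RB_algebra (fps_scale sA) (fps_scale sM) (fps_ops D)"

definition equivalent_deformations ::
  "('k::comm_ring_1 \<Rightarrow> 'a::ab_group_add \<Rightarrow> 'a) \<Rightarrow> ('k \<Rightarrow> 'm::ab_group_add \<Rightarrow> 'm) \<Rightarrow>
   (nat \<Rightarrow> ('a, 'm, 'x) mrrb_ops) \<Rightarrow> (nat \<Rightarrow> ('a, 'm, 'x) mrrb_ops) \<Rightarrow> bool" where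
  "equivalent_deformations sA sM D D' \<longleftrightarrow>
     (\<exists>(\<phi> :: nat \<Rightarrow> 'a \<Rightarrow> 'a) (\<psi> :: nat \<Rightarrow> 'm \<Rightarrow> 'm).
        \<phi> 0 = id \<and> \<psi> 0 = id \<and>
        (\<forall>i. module_hom sA sA (\<phi> i)) \<and> (\<forall>i. module_hom sM sM (\<psi> i)) \<and>
        bij (fps_linear_ext \<phi>) \<and> bij (fps_linear_ext \<psi>) \<and>
        mrrb_morphism (fps_scale sA) (fps_scale sM) (fps_ops D)
          (fps_scale sA) (fps_scale sM) (fps_ops D')
          (fps_linear_ext \<phi>) (fps_linear_ext \<psi>))"

section \<open>The cochain complex\<close>

text \<open>
  An \<open>n\<close>-linear map is a function on lists of length \<open>n\<close>; it is required to vanish on all other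
  lists, so that equality of cochains is equality of functions. A pure tensor of
  \<open>\<A>\<^bsup>n-1,1\<^esup>\<close> is a list over \<open>'a + 'm\<close> of length \<open>n\<close> with exactly one entry from \<open>'m\<close>.
\<close>

definition multilinear_maps ::
  "('k::comm_ring_1 \<Rightarrow> 'a::ab_group_add \<Rightarrow> 'a) \<Rightarrow> ('k \<Rightarrow> 'b::ab_group_add \<Rightarrow> 'b) \<Rightarrow> nat \<Rightarrow>
   ('a list \<Rightarrow> 'b) set" where
  "multilinear_maps s s' n =
     {f. (\<forall>as. length as \<noteq> n \<longrightarrow> f as = 0) \<and>
         (\<forall>as bs. length as + length bs + 1 = n \<longrightarrow> module_hom s s' (\<lambda>a. f (as @ a # bs)))}"

definition mixed_words :: "nat \<Rightarrow> ('a + 'm) list set" where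
  "mixed_words n = {ws. length ws = n \<and> length (filter (\<lambda>w. \<not> isl w) ws) = 1}"

definition mixed_maps ::
  "('k::comm_ring_1 \<Rightarrow> 'a::ab_group_add \<Rightarrow> 'a) \<Rightarrow> ('k \<Rightarrow> 'm::ab_group_add \<Rightarrow> 'm) \<Rightarrow> nat \<Rightarrow>
   (('a + 'm) list \<Rightarrow> 'm) set" where
  "mixed_maps sA sM n =
     {\<beta>. (\<forall>ws. ws \<notin> mixed_words n \<longrightarrow> \<beta> ws = 0) \<and>
         (\<forall>vs ws. vs @ Inl 0 # ws \<in> mixed_words n \<longrightarrow>
            module_hom sA sM (\<lambda>a. \<beta> (vs @ Inl a # ws))) \<and>
         (\<forall>vs ws. vs @ Inr 0 # ws \<in> mixed_words n \<longrightarrow>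
            module_hom sM sM (\<lambda>u. \<beta> (vs @ Inr u # ws)))}"

definition rb_cochains ::
  "('k::comm_ring_1 \<Rightarrow> 'a::ab_group_add \<Rightarrow> 'a) \<Rightarrow> ('k \<Rightarrow> 'm::ab_group_add \<Rightarrow> 'm) \<Rightarrow> nat \<Rightarrow>
   ('x list \<Rightarrow> 'm list \<Rightarrow> 'a) set" where
  "rb_cochains sA sM n =
     {f. \<forall>xs. if length xs = n then f xs \<in> multilinear_maps sM sA n else f xs = 0}"

type_synonym ('a, 'm, 'x) cochain =
  "('a list \<Rightarrow> 'a) \<times> (('a + 'm) list \<Rightarrow> 'm) \<times> ('x list \<Rightarrow> 'm list \<Rightarrow> 'a)"

text \<open>All degrees share one type of triples; in degree 1 the third component is \<open>0\<close>.\<close>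

definition mrrb_cochains ::
  "('k::comm_ring_1 \<Rightarrow> 'a::ab_group_add \<Rightarrow> 'a) \<Rightarrow> ('k \<Rightarrow> 'm::ab_group_add \<Rightarrow> 'm) \<Rightarrow> nat \<Rightarrow>
   ('a, 'm, 'x) cochain set" where
  "mrrb_cochains sA sM n =
     (if n = 0 then {0}
      else if n = 1 then multilinear_maps sA sA 1 \<times> mixed_maps sA sM 1 \<times> {0}
      else multilinear_maps sA sA n \<times> mixed_maps sA sM n \<times> rb_cochains sA sM (n - 1))"

definition alt_sign :: "nat \<Rightarrow> 'a::ab_group_add \<Rightarrow> 'a" where
  "alt_sign i a = (if even i then a else - a)"

text \<open>
  Replaces the entries at the (1-based) positions \<open>i\<close> and \<open>i + 1\<close> by their product. In the
  differentials below, list indices are 0-based while \<open>i\<close> ranges over \<open>1, \<dots>, n\<close>, so \<open>u\<^sub>i\<close> is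
  \<open>us ! (i - 1)\<close> and \<open>u\<^sub>i\<^sub>+\<^sub>1\<close> is \<open>us ! i\<close>.
\<close>

definition contract :: "('w \<Rightarrow> 'w \<Rightarrow> 'w) \<Rightarrow> nat \<Rightarrow> 'w list \<Rightarrow> 'w list" where
  "contract m i ws = take (i - 1) ws @ m (ws ! (i - 1)) (ws ! i) # drop (i + 1) ws"

definition hochschild ::
  "('a::ab_group_add \<Rightarrow> 'a \<Rightarrow> 'a) \<Rightarrow> nat \<Rightarrow> ('a list \<Rightarrow> 'a) \<Rightarrow> 'a list \<Rightarrow> 'a" where
  "hochschild m n f as =
     (if length as = n + 1 then
        m (hd as) (f (tl as))
        + (\<Sum>i=1..n. alt_sign i (f (contract m i as)))
        + alt_sign (n + 1) (m (f (butlast as)) (last as))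
      else 0)"

text \<open>
  The next three functions are \<open>l\<^sub>M + r\<^sub>M\<close>, \<open>\<mu> + l\<^sub>M + r\<^sub>M\<close> and \<open>\<alpha> + \<beta>\<close>, where the summand is
  selected by the arguments; the value \<open>0\<close> for argument combinations without such a summand is
  never used on \<^const>\<open>mixed_words\<close>.
\<close>

fun mixed_act ::
  "('a::ab_group_add, 'm::ab_group_add, 'x) mrrb_ops \<Rightarrow> 'a + 'm \<Rightarrow> 'a + 'm \<Rightarrow> 'm" where
  "mixed_act S (Inl a) (Inr u) = lact S a u"
| "mixed_act S (Inr u) (Inl a) = ract S u a"
| "mixed_act S (Inl a) (Inl b) = 0"
| "mixed_act S (Inr u) (Inr v) = 0"

fun mixed_mul ::
  "('a::ab_group_add, 'm::ab_group_add, 'x) mrrb_ops \<Rightarrow> 'a + 'm \<Rightarrow> 'a + 'm \<Rightarrow> 'a + 'm" where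
  "mixed_mul S (Inl a) (Inl b) = Inl (mul S a b)"
| "mixed_mul S (Inl a) (Inr u) = Inr (lact S a u)"
| "mixed_mul S (Inr u) (Inl a) = Inr (ract S u a)"
| "mixed_mul S (Inr u) (Inr v) = Inr 0"

definition mixed_apply ::
  "('a list \<Rightarrow> 'a) \<Rightarrow> (('a + 'm) list \<Rightarrow> 'm) \<Rightarrow> ('a + 'm) list \<Rightarrow> 'a + 'm" where
  "mixed_apply \<alpha> \<beta> ws = (if list_all isl ws then Inl (\<alpha> (map projl ws)) else Inr (\<beta> ws))"

definition mixed_hochschild ::
  "('a::ab_group_add, 'm::ab_group_add, 'x) mrrb_ops \<Rightarrow> nat \<Rightarrow> ('a list \<Rightarrow> 'a) \<Rightarrow>
   (('a + 'm) list \<Rightarrow> 'm) \<Rightarrow> ('a + 'm) list \<Rightarrow> 'm" where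
  "mixed_hochschild S n \<alpha> \<beta> ws =
     (if ws \<in> mixed_words (n + 1) then
        mixed_act S (hd ws) (mixed_apply \<alpha> \<beta> (tl ws))
        + (\<Sum>i=1..n. alt_sign i (\<beta> (contract (mixed_mul S) i ws)))
        + alt_sign (n + 1) (mixed_act S (mixed_apply \<alpha> \<beta> (butlast ws)) (last ws))
      else 0)"

definition rb_diff ::
  "('a::ab_group_add, 'm::ab_group_add, 'x) mrrb_ops \<Rightarrow> nat \<Rightarrow>
   ('x list \<Rightarrow> 'm list \<Rightarrow> 'a) \<Rightarrow> 'x list \<Rightarrow> 'm list \<Rightarrow> 'a" where
  "rb_diff S n f xs us =
     (if length xs = n + 1 \<and> length us = n + 1 then
        mul S (rb S (hd xs) (hd us)) (f (tl xs) (tl us))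
        - rb S (hd xs) (ract S (hd us) (f (tl xs) (tl us)))
        + (\<Sum>i=1..n. alt_sign i
             (f (take i xs @ drop (i + 1) xs)
                (take (i - 1) us @ ract S (us ! (i - 1)) (rb S (xs ! i) (us ! i)) # drop (i + 1) us)))
        + (\<Sum>i=1..n. alt_sign i
             (f (take (i - 1) xs @ drop i xs)
                (take (i - 1) us @ lact S (rb S (xs ! (i - 1)) (us ! (i - 1))) (us ! i)
                   # drop (i + 1) us)))
        + alt_sign (n + 1) (mul S (f (butlast xs) (butlast us)) (rb S (last xs) (last us)))
        - alt_sign (n + 1) (rb S (last xs) (lact S (f (butlast xs) (butlast us)) (last us)))
      else 0)"

definition rb_h ::
  "('a::ab_group_add, 'm::ab_group_add, 'x) mrrb_ops \<Rightarrow> nat \<Rightarrow> ('a list \<Rightarrow> 'a) \<Rightarrow>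
   (('a + 'm) list \<Rightarrow> 'm) \<Rightarrow> 'x list \<Rightarrow> 'm list \<Rightarrow> 'a" where
  "rb_h S n \<alpha> \<beta> xs us =
     (if length xs = n \<and> length us = n then
        alt_sign n
          (\<alpha> (map2 (rb S) xs us)
           - (\<Sum>i=1..n. rb S (xs ! (i - 1))
                (\<beta> ((map Inl (map2 (rb S) xs us)) [i - 1 := Inr (us ! (i - 1))]))))
      else 0)"

fun mrrb_diff ::
  "('a::ab_group_add, 'm::ab_group_add, 'x) mrrb_ops \<Rightarrow> nat \<Rightarrow>
   ('a, 'm, 'x) cochain \<Rightarrow> ('a, 'm, 'x) cochain" where
  "mrrb_diff S n (\<alpha>, \<beta>, \<gamma>) =
     (if n = 0 then 0
      else if n = 1 then
        (hochschild (mul S) 1 \<alpha>, mixed_hochschild S 1 \<alpha> \<beta>, rb_h S 1 \<alpha> \<beta>)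
      else
        (hochschild (mul S) n \<alpha>, mixed_hochschild S n \<alpha> \<beta>,
         rb_diff S (n - 1) \<gamma> + rb_h S n \<alpha> \<beta>))"

definition mrrb_cocycles ::
  "('k::comm_ring_1 \<Rightarrow> 'a::ab_group_add \<Rightarrow> 'a) \<Rightarrow> ('k \<Rightarrow> 'm::ab_group_add \<Rightarrow> 'm) \<Rightarrow>
   ('a, 'm, 'x) mrrb_ops \<Rightarrow> nat \<Rightarrow> ('a, 'm, 'x) cochain set" where
  "mrrb_cocycles sA sM S n = {c \<in> mrrb_cochains sA sM n. mrrb_diff S n c = 0}"

definition mrrb_coboundaries ::
  "('k::comm_ring_1 \<Rightarrow> 'a::ab_group_add \<Rightarrow> 'a) \<Rightarrow> ('k \<Rightarrow> 'm::ab_group_add \<Rightarrow> 'm) \<Rightarrow>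
   ('a, 'm, 'x) mrrb_ops \<Rightarrow> nat \<Rightarrow> ('a, 'm, 'x) cochain set" where
  "mrrb_coboundaries sA sM S n =
     (if n = 0 then {0} else mrrb_diff S (n - 1) ` mrrb_cochains sA sM (n - 1))"

definition cohomologous ::
  "('k::comm_ring_1 \<Rightarrow> 'a::ab_group_add \<Rightarrow> 'a) \<Rightarrow> ('k \<Rightarrow> 'm::ab_group_add \<Rightarrow> 'm) \<Rightarrow>
   ('a, 'm, 'x) mrrb_ops \<Rightarrow> nat \<Rightarrow> ('a, 'm, 'x) cochain rel" where
  "cohomologous sA sM S n =
     {(c, c'). c \<in> mrrb_cocycles sA sM S n \<and> c' \<in> mrrb_cocycles sA sM S n \<and>
               c - c' \<in> mrrb_coboundaries sA sM S n}"

definition mrrb_cohomology ::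
  "('k::comm_ring_1 \<Rightarrow> 'a::ab_group_add \<Rightarrow> 'a) \<Rightarrow> ('k \<Rightarrow> 'm::ab_group_add \<Rightarrow> 'm) \<Rightarrow>
   ('a, 'm, 'x) mrrb_ops \<Rightarrow> nat \<Rightarrow> ('a, 'm, 'x) cochain set set" where
  "mrrb_cohomology sA sM S n = mrrb_cocycles sA sM S n // cohomologous sA sM S n"

definition cohomology_class ::
  "('k::comm_ring_1 \<Rightarrow> 'a::ab_group_add \<Rightarrow> 'a) \<Rightarrow> ('k \<Rightarrow> 'm::ab_group_add \<Rightarrow> 'm) \<Rightarrow>
   ('a, 'm, 'x) mrrb_ops \<Rightarrow> nat \<Rightarrow> ('a, 'm, 'x) cochain \<Rightarrow> ('a, 'm, 'x) cochain set" where
  "cohomology_class sA sM S n c = cohomologous sA sM S n `` {c}"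

section \<open>The infinitesimal of a deformation\<close>

definition infinitesimal ::
  "(nat \<Rightarrow> ('a::ab_group_add, 'm::ab_group_add, 'x) mrrb_ops) \<Rightarrow> ('a, 'm, 'x) cochain" where
  "infinitesimal D =
     ((\<lambda>as. case as of [a, b] \<Rightarrow> mul (D 1) a b | _ \<Rightarrow> 0),
      (\<lambda>ws. case ws of [Inl a, Inr u] \<Rightarrow> lact (D 1) a u
                     | [Inr u, Inl a] \<Rightarrow> ract (D 1) u a
                     | _ \<Rightarrow> 0),
      (\<lambda>xs us. case (xs, us) of ([x], [u]) \<Rightarrow> rb (D 1) x u | _ \<Rightarrow> 0))"

end

theory Submission
  imports Defs
begin

text \<open>
  Each axiom of a matching relative Rota-Baxter algebra is an equation between composites of the
  structure maps, so for a deformation the coefficient of \<open>t\<close>, evaluated on constant series, is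
  the Leibniz rule applied to that equation: a sum of copies of the undeformed equation, in each
  of which one structure map has been replaced by its first-order term. Moving everything to one
  side gives exactly the vanishing of \<^const>\<open>mrrb_diff\<close> on the infinitesimal: associativity is
  the Hochschild component, the three bimodule axioms are the mixed component on the three
  positions of the module argument, and the Rota-Baxter identity is the last component, in which
  the terms differentiating \<open>P\<close> form \<^const>\<open>rb_diff\<close> and the terms differentiating \<open>\<mu>\<close>, \<open>l\<close>, \<open>r\<close>
  form \<^const>\<open>rb_h\<close> (lemma \<open>infinitesimal_cocycle\<close>).

  Expanding in the same way the equations which say that \<open>(\<phi>\<^sub>t, \<psi>\<^sub>t)\<close> is a morphism shows that the
  infinitesimals of equivalent deformations differ by the coboundary of \<open>(\<phi>\<^sub>1, \<psi>\<^sub>1)\<close>, because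
  \<open>\<phi>\<^sub>0\<close> and \<open>\<psi>\<^sub>0\<close> are identities (lemma \<open>infinitesimal_diff_coboundary\<close>). Equality of the
  cohomology classes then follows once being cohomologous is known to be an equivalence relation,
  for which it suffices that the differential is additive and the cochains form a subgroup.
\<close>

section \<open>Linearity of the structure maps\<close>

lemma module_bilinear_diff_right:
  "module_bilinear s1 s2 s3 f \<Longrightarrow> f x (y - y') = f x y - f x y'"
  unfolding module_bilinear_def by (blast intro: module_hom.diff)

lemma module_bilinear_diff_left:
  "module_bilinear s1 s2 s3 f \<Longrightarrow> f (x - x') y = f x y - f x' y"
  using module_hom.diff[of s1 s3 "\<lambda>x. f x y"] unfolding module_bilinear_def by blast

lemma module_bilinear_zero_right: "module_bilinear s1 s2 s3 f \<Longrightarrow> f x 0 = 0"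
  unfolding module_bilinear_def by (blast intro: module_hom.zero)

lemma module_bilinear_zero_left: "module_bilinear s1 s2 s3 f \<Longrightarrow> f 0 y = 0"
  using module_hom.zero[of s1 s3 "\<lambda>x. f x y"] unfolding module_bilinear_def by blast

lemmas module_bilinear_diff = module_bilinear_diff_left module_bilinear_diff_right
lemmas module_bilinear_zero = module_bilinear_zero_left module_bilinear_zero_right

lemma matching_rel_RB_algebraD:
  assumes "matching_rel_RB_algebra sA sM S"
  shows "module sA" "module sM"
    and "module_bilinear sA sA sA (mul S)"
    and "module_bilinear sA sM sM (lact S)"
    and "module_bilinear sM sA sM (ract S)"
    and "module_hom sM sA (rb S x)"
    and "mul S (mul S a b) c = mul S a (mul S b c)"
    and "lact S (mul S a b) u = lact S a (lact S b u)"
    and "ract S u (mul S a b) = ract S (ract S u a) b"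
    and "ract S (lact S a u) b = lact S a (ract S u b)"
    and "mul S (rb S x u) (rb S y v) =
           rb S x (ract S u (rb S y v)) + rb S y (lact S (rb S x u) v)"
  using assms
  unfolding matching_rel_RB_algebra_def associative_algebra_def algebra_bimodule_def
  by blast+

section \<open>Being cohomologous is an equivalence relation\<close>

lemma alt_sign_diff: "alt_sign i (a - b) = alt_sign i a - alt_sign i b"
  by (simp add: alt_sign_def)

lemma alt_sign_eval:
  "alt_sign 0 a = a" "alt_sign (Suc i) a = - alt_sign i a"
  "alt_sign 2 a = a" "alt_sign 3 a = - a"
  by (simp_all add: alt_sign_def)

lemma hochschild_diff:
  assumes "module_bilinear s s s m"
  shows "hochschild m n (f - g) = hochschild m n f - hochschild m n g"
  by (rule ext)
     (simp add: hochschild_def module_bilinear_diff[OF assms] alt_sign_diff sum_subtractf)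

lemma mixed_act_apply_diff:
  assumes "module_bilinear sA sM sM (lact S)" and "module_bilinear sM sA sM (ract S)"
  shows "mixed_act S w (mixed_apply (\<alpha> - \<alpha>') (\<beta> - \<beta>') ws) =
           mixed_act S w (mixed_apply \<alpha> \<beta> ws) - mixed_act S w (mixed_apply \<alpha>' \<beta>' ws)"
    and "mixed_act S (mixed_apply (\<alpha> - \<alpha>') (\<beta> - \<beta>') ws) w =
           mixed_act S (mixed_apply \<alpha> \<beta> ws) w - mixed_act S (mixed_apply \<alpha>' \<beta>' ws) w"
  by (cases w; simp add: mixed_apply_def module_bilinear_diff[OF assms(1)]
        module_bilinear_diff[OF assms(2)])+

lemma mixed_hochschild_diff:
  assumes "module_bilinear sA sM sM (lact S)" and "module_bilinear sM sA sM (ract S)"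
  shows "mixed_hochschild S n (\<alpha> - \<alpha>') (\<beta> - \<beta>') =
           mixed_hochschild S n \<alpha> \<beta> - mixed_hochschild S n \<alpha>' \<beta>'"
  by (rule ext)
     (simp add: mixed_hochschild_def mixed_act_apply_diff[OF assms] alt_sign_diff sum_subtractf)

lemma rb_diff_diff:
  assumes "matching_rel_RB_algebra sA sM S"
  shows "rb_diff S n (f - g) = rb_diff S n f - rb_diff S n g"
  by (intro ext)
     (simp add: rb_diff_def alt_sign_diff sum_subtractf
        module_bilinear_diff[OF matching_rel_RB_algebraD(3)[OF assms]]
        module_bilinear_diff[OF matching_rel_RB_algebraD(4)[OF assms]]
        module_bilinear_diff[OF matching_rel_RB_algebraD(5)[OF assms]]
        module_hom.diff[OF matching_rel_RB_algebraD(6)[OF assms]])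

lemma rb_h_diff:
  assumes "\<And>x. module_hom sM sA (rb S x)"
  shows "rb_h S n (\<alpha> - \<alpha>') (\<beta> - \<beta>') = rb_h S n \<alpha> \<beta> - rb_h S n \<alpha>' \<beta>'"
  by (intro ext) (simp add: rb_h_def alt_sign_diff sum_subtractf module_hom.diff[OF assms])

text \<open>
  Additivity is expressed through differences because a nonempty set that is closed under
  differences is a subgroup: reflexivity, symmetry and transitivity of \<^const>\<open>cohomologous\<close> all
  follow once the coboundaries contain \<open>0\<close> and are closed under differences.
\<close>

lemma mrrb_diff_diff:
  assumes "matching_rel_RB_algebra sA sM S"
  shows "mrrb_diff S n (c - c') = mrrb_diff S n c - mrrb_diff S n c'"
  using matching_rel_RB_algebraD(3-6)[OF assms]
  by (cases c; cases c')
     (simp add: hochschild_diff mixed_hochschild_diff rb_diff_diff[OF assms]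
        rb_h_diff[of sM sA S] zero_prod_def)

lemma zero_in_multilinear_maps:
  "module s \<Longrightarrow> module s' \<Longrightarrow> 0 \<in> multilinear_maps s s' n"
  by (simp add: multilinear_maps_def module_pair.module_hom_zero module_pair.intro)

lemma zero_in_mixed_maps:
  "module sA \<Longrightarrow> module sM \<Longrightarrow> 0 \<in> mixed_maps sA sM n"
  by (simp add: mixed_maps_def module_pair.module_hom_zero module_pair.intro)

lemma diff_in_multilinear_maps:
  assumes "module s" "module s'"
    and "f \<in> multilinear_maps s s' n" "g \<in> multilinear_maps s s' n"
  shows "f - g \<in> multilinear_maps s s' n"
  using assms by (simp add: multilinear_maps_def module_pair.module_hom_sub module_pair.intro)

lemma diff_in_mixed_maps:
  assumes "module sA" "module sM"
    and "f \<in> mixed_maps sA sM n" "g \<in> mixed_maps sA sM n"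
  shows "f - g \<in> mixed_maps sA sM n"
  using assms by (simp add: mixed_maps_def module_pair.module_hom_sub module_pair.intro)

lemma diff_in_rb_cochains:
  assumes "module sA" "module sM"
    and "f \<in> rb_cochains sA sM n" "g \<in> rb_cochains sA sM n"
  shows "f - g \<in> rb_cochains sA sM n"
  using assms by (auto simp add: rb_cochains_def diff_in_multilinear_maps split: if_splits)

lemma diff_in_mrrb_cochains:
  assumes "module sA" "module sM"
    and "c \<in> mrrb_cochains sA sM n" "c' \<in> mrrb_cochains sA sM n"
  shows "c - c' \<in> mrrb_cochains sA sM n"
  using assms
  by (auto simp add: mrrb_cochains_def diff_in_multilinear_maps diff_in_mixed_maps
        diff_in_rb_cochains split: if_splits)

lemma zero_in_mrrb_cochains:
  assumes "module sA" "module sM"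
  shows "0 \<in> mrrb_cochains sA sM n"
  using assms
  by (auto simp add: mrrb_cochains_def zero_prod_def zero_in_multilinear_maps zero_in_mixed_maps
        rb_cochains_def)

lemma diff_in_mrrb_coboundaries:
  assumes S: "matching_rel_RB_algebra sA sM S"
    and "b \<in> mrrb_coboundaries sA sM S n" "b' \<in> mrrb_coboundaries sA sM S n"
  shows "b - b' \<in> mrrb_coboundaries sA sM S n"
proof (cases "n = 0")
  case False
  then obtain c c' where c: "b = mrrb_diff S (n - 1) c" "c \<in> mrrb_cochains sA sM (n - 1)"
      "b' = mrrb_diff S (n - 1) c'" "c' \<in> mrrb_cochains sA sM (n - 1)"
    using assms(2,3) by (auto simp: mrrb_coboundaries_def)
  then show ?thesis
    using False diff_in_mrrb_cochains[OF matching_rel_RB_algebraD(1,2)[OF S] c(2,4)]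
    by (simp add: mrrb_coboundaries_def flip: mrrb_diff_diff[OF S])
qed (use assms in \<open>simp add: mrrb_coboundaries_def\<close>)

lemma zero_in_mrrb_coboundaries:
  assumes S: "matching_rel_RB_algebra sA sM S"
  shows "0 \<in> mrrb_coboundaries sA sM S n"
proof (cases "n = 0")
  case False
  have "mrrb_diff S (n - 1) 0 = 0"
    using mrrb_diff_diff[OF S, of "n - 1" 0 0] by simp
  then show ?thesis
    using False zero_in_mrrb_cochains[OF matching_rel_RB_algebraD(1,2)[OF S], of "n - 1"]
    by (force simp: mrrb_coboundaries_def)
qed (simp add: mrrb_coboundaries_def)

lemma equiv_cohomologous:
  assumes S: "matching_rel_RB_algebra sA sM S"
  shows "equiv (mrrb_cocycles sA sM S n) (cohomologous sA sM S n)"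
proof -
  let ?B = "mrrb_coboundaries sA sM S n"
  note zero = zero_in_mrrb_coboundaries[OF S, of n]
  have minus: "c' - c \<in> ?B" if "c - c' \<in> ?B" for c c'
    using diff_in_mrrb_coboundaries[OF S zero that] by simp
  have plus: "c - c'' \<in> ?B" if "c - c' \<in> ?B" "c' - c'' \<in> ?B" for c c' c''
    using diff_in_mrrb_coboundaries[OF S that(1) minus[OF that(2)]] by simp
  show ?thesis
  proof (rule equivI)
    show "refl_on (mrrb_cocycles sA sM S n) (cohomologous sA sM S n)"
      by (simp add: refl_on_def cohomologous_def zero)
    show "sym (cohomologous sA sM S n)"
      unfolding sym_def cohomologous_def using minus by blast
    show "trans (cohomologous sA sM S n)"
      unfolding trans_def cohomologous_def using plus by blast
  qed (auto simp: cohomologous_def)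
qed

section \<open>Coefficients of low order\<close>

lemma fps_linear_ext_nth_low:
  "fps_nth (fps_linear_ext p f) 0 = p 0 (fps_nth f 0)"
  "fps_nth (fps_linear_ext p f) 1 = p 0 (fps_nth f 1) + p 1 (fps_nth f 0)"
  by (simp_all add: fps_linear_ext_def)

lemma fps_bilinear_ext_nth_low:
  "fps_nth (fps_bilinear_ext p f g) 0 = p 0 (fps_nth f 0) (fps_nth g 0)"
  "fps_nth (fps_bilinear_ext p f g) 1 =
     p 0 (fps_nth f 0) (fps_nth g 1) + p 0 (fps_nth f 1) (fps_nth g 0)
     + p 1 (fps_nth f 0) (fps_nth g 0)"
  by (simp_all add: fps_bilinear_ext_def)

lemmas nth_low =
  fps_linear_ext_nth_low fps_linear_ext_nth_low(2)[simplified]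
  fps_bilinear_ext_nth_low fps_bilinear_ext_nth_low(2)[simplified]

lemma fps_ops_simps:
  "mul (fps_ops D) = fps_bilinear_ext (\<lambda>i. mul (D i))"
  "lact (fps_ops D) = fps_bilinear_ext (\<lambda>i. lact (D i))"
  "ract (fps_ops D) = fps_bilinear_ext (\<lambda>i. ract (D i))"
  "rb (fps_ops D) x = fps_linear_ext (\<lambda>i. rb (D i) x)"
  by (simp_all add: fps_ops_def)

lemma formal_deformationD:
  assumes "formal_deformation sA sM S D"
  shows "D 0 = S"
    and "module_bilinear sA sA sA (mul (D i))"
    and "module_bilinear sA sM sM (lact (D i))"
    and "module_bilinear sM sA sM (ract (D i))"
    and "module_hom sM sA (rb (D i) x)"
    and "matching_rel_RB_algebra (fps_scale sA) (fps_scale sM) (fps_ops D)"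
  using assms unfolding formal_deformation_def by auto

text \<open>
  The coefficient of \<open>t\<close> in each axiom of the deformed structure, read off on constant series.
  Terms in which a structure map of order 0 meets the first-order coefficient of a constant
  vanish by bilinearity, which leaves the Leibniz rule.
\<close>

lemma first_order_identities:
  assumes D: "formal_deformation sA sM S D"
  shows "mul S (mul (D 1) a b) c + mul (D 1) (mul S a b) c =
           mul S a (mul (D 1) b c) + mul (D 1) a (mul S b c)" (is ?assoc)
    and "lact S (mul (D 1) a b) u + lact (D 1) (mul S a b) u =
           lact S a (lact (D 1) b u) + lact (D 1) a (lact S b u)" (is ?left)
    and "ract S u (mul (D 1) a b) + ract (D 1) u (mul S a b) =
           ract S (ract (D 1) u a) b + ract (D 1) (ract S u a) b" (is ?right)
    and "ract S (lact (D 1) a u) b + ract (D 1) (lact S a u) b =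
           lact S a (ract (D 1) u b) + lact (D 1) a (ract S u b)" (is ?middle)
    and "mul S (rb S x u) (rb (D 1) y v) + mul S (rb (D 1) x u) (rb S y v)
           + mul (D 1) (rb S x u) (rb S y v) =
         rb S x (ract S u (rb (D 1) y v)) + rb S x (ract (D 1) u (rb S y v))
           + rb (D 1) x (ract S u (rb S y v))
           + (rb S y (lact S (rb (D 1) x u) v) + rb S y (lact (D 1) (rb S x u) v)
           + rb (D 1) y (lact S (rb S x u) v))" (is ?rota_baxter)
proof -
  note D0 = formal_deformationD(1)[OF D]
  note low = D0 nth_low fps_ops_simps
    module_bilinear_zero[OF formal_deformationD(2)[OF D, of 0, unfolded D0]]
    module_bilinear_zero[OF formal_deformationD(3)[OF D, of 0, unfolded D0]]
    module_bilinear_zero[OF formal_deformationD(4)[OF D, of 0, unfolded D0]]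
    module_hom.zero[OF formal_deformationD(5)[OF D, of 0, unfolded D0]]
    module_hom.add[OF formal_deformationD(5)[OF D, of 0, unfolded D0]]
  note axioms = matching_rel_RB_algebraD(7-11)[OF formal_deformationD(6)[OF D]]
  show ?assoc
    using arg_cong[OF axioms(1)[of "fps_const a" "fps_const b" "fps_const c"],
        of "\<lambda>f. fps_nth f 1"]
    by (simp add: low)
  show ?left
    using arg_cong[OF axioms(2)[of "fps_const a" "fps_const b" "fps_const u"],
        of "\<lambda>f. fps_nth f 1"]
    by (simp add: low)
  show ?right
    using arg_cong[OF axioms(3)[of "fps_const u" "fps_const a" "fps_const b"],
        of "\<lambda>f. fps_nth f 1"]
    by (simp add: low)
  show ?middle
    using arg_cong[OF axioms(4)[of "fps_const a" "fps_const u" "fps_const b"],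
        of "\<lambda>f. fps_nth f 1"]
    by (simp add: low)
  show ?rota_baxter
    using arg_cong[OF axioms(5)[of x "fps_const u" y "fps_const v"], of "\<lambda>f. fps_nth f 1"]
    by (simp add: low)
qed

section \<open>The infinitesimal is a cocycle\<close>

lemma mixed_words_2:
  "ws \<in> mixed_words 2 \<longleftrightarrow> (\<exists>a u. ws = [Inl a, Inr u]) \<or> (\<exists>u a. ws = [Inr u, Inl a])"
proof
  assume "ws \<in> mixed_words 2"
  then obtain v w where "ws = [v, w]" and "length (filter (\<lambda>w. \<not> isl w) [v, w]) = 1"
    by (auto simp: mixed_words_def length_Suc_conv numeral_2_eq_2)
  then show "(\<exists>a u. ws = [Inl a, Inr u]) \<or> (\<exists>u a. ws = [Inr u, Inl a])"
    by (cases v; cases w) auto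
qed (auto simp: mixed_words_def)

lemma mixed_words_3_cases:
  assumes "ws \<in> mixed_words 3"
  obtains (left) a b u where "ws = [Inl a, Inl b, Inr u]"
    | (middle) a u b where "ws = [Inl a, Inr u, Inl b]"
    | (right) u a b where "ws = [Inr u, Inl a, Inl b]"
proof -
  obtain v w z where "ws = [v, w, z]" and "length (filter (\<lambda>w. \<not> isl w) [v, w, z]) = 1"
    using assms by (auto simp: mixed_words_def length_Suc_conv numeral_3_eq_3)
  then show thesis
    using that by (cases v; cases w; cases z) auto
qed

lemma two_letter_split:
  "length as + length bs + 1 = 2 \<longleftrightarrow> (\<exists>b. as = [] \<and> bs = [b]) \<or> (\<exists>a. as = [a] \<and> bs = [])"
  by (cases as; cases bs) (auto simp: length_Suc_conv)

text \<open>
  The vanishing off the proper arguments is recorded together with the values: cochains are total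
  functions on lists, so membership and equality of cochains also concern those arguments.
\<close>

lemma infinitesimal_components:
  obtains \<alpha> \<beta> \<gamma> where "infinitesimal D = (\<alpha>, \<beta>, \<gamma>)"
    and "\<And>a b. \<alpha> [a, b] = mul (D 1) a b" and "\<And>as. length as \<noteq> 2 \<Longrightarrow> \<alpha> as = 0"
    and "\<And>a u. \<beta> [Inl a, Inr u] = lact (D 1) a u"
    and "\<And>u a. \<beta> [Inr u, Inl a] = ract (D 1) u a"
    and "\<And>ws. ws \<notin> mixed_words 2 \<Longrightarrow> \<beta> ws = 0"
    and "\<And>x u. \<gamma> [x] [u] = rb (D 1) x u" and "\<And>xs. length xs \<noteq> 1 \<Longrightarrow> \<gamma> xs = 0"
    and "\<And>xs us. length us \<noteq> 1 \<Longrightarrow> \<gamma> xs us = 0"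
  by (rule that[OF infinitesimal_def])
     (auto simp: mixed_words_2 fun_eq_iff split: list.split sum.split)

lemma infinitesimal_in_cochains:
  assumes D: "formal_deformation sA sM S D"
  shows "infinitesimal D \<in> mrrb_cochains sA sM 2"
proof -
  note bil = formal_deformationD(2-5)[OF D, of 1, unfolded module_bilinear_def]
  obtain \<alpha> \<beta> \<gamma> where inf: "infinitesimal D = (\<alpha>, \<beta>, \<gamma>)"
    and \<alpha>: "\<And>a b. \<alpha> [a, b] = mul (D 1) a b" "\<And>as. length as \<noteq> 2 \<Longrightarrow> \<alpha> as = 0"
    and \<beta>: "\<And>a u. \<beta> [Inl a, Inr u] = lact (D 1) a u"
      "\<And>u a. \<beta> [Inr u, Inl a] = ract (D 1) u a" "\<And>ws. ws \<notin> mixed_words 2 \<Longrightarrow> \<beta> ws = 0"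
    and \<gamma>: "\<And>x u. \<gamma> [x] [u] = rb (D 1) x u" "\<And>xs. length xs \<noteq> 1 \<Longrightarrow> \<gamma> xs = 0"
      "\<And>xs us. length us \<noteq> 1 \<Longrightarrow> \<gamma> xs us = 0"
    by (rule infinitesimal_components[of D]) blast
  have "\<alpha> \<in> multilinear_maps sA sA 2"
    using bil \<alpha> unfolding multilinear_maps_def two_letter_split by auto
  moreover have "\<beta> \<in> mixed_maps sA sM 2"
    using bil \<beta> unfolding mixed_maps_def
    by (auto simp: mixed_words_2 Cons_eq_append_conv append_eq_Cons_conv)
  moreover have "\<gamma> \<in> rb_cochains sA sM 1"
    using bil \<gamma> by (auto simp: rb_cochains_def multilinear_maps_def length_Suc_conv)
  ultimately show ?thesis
    by (simp add: inf mrrb_cochains_def)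
qed

lemma infinitesimal_cocycle:
  assumes D: "formal_deformation sA sM S D"
  shows "infinitesimal D \<in> mrrb_cocycles sA sM S 2"
proof -
  obtain \<alpha> \<beta> \<gamma> where inf: "infinitesimal D = (\<alpha>, \<beta>, \<gamma>)"
    and \<alpha>: "\<And>a b. \<alpha> [a, b] = mul (D 1) a b"
    and \<beta>: "\<And>a u. \<beta> [Inl a, Inr u] = lact (D 1) a u"
      "\<And>u a. \<beta> [Inr u, Inl a] = ract (D 1) u a"
    and \<gamma>: "\<And>x u. \<gamma> [x] [u] = rb (D 1) x u"
    by (rule infinitesimal_components[of D]) blast
  note eval = contract_def alt_sign_eval \<alpha> \<beta> \<gamma> numeral_2_eq_2 mixed_apply_def
  note first_order = first_order_identities[OF D, simplified]
  have "hochschild (mul S) 2 \<alpha> as = 0" for as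
  proof (cases "length as = 3")
    case True
    then obtain a b c where "as = [a, b, c]"
      by (auto simp: length_Suc_conv numeral_3_eq_3)
    then show ?thesis
      using first_order(1)[of a b c] by (simp add: hochschild_def eval algebra_simps)
  qed (simp add: hochschild_def)
  moreover have "mixed_hochschild S 2 \<alpha> \<beta> ws = 0" for ws
  proof (cases "ws \<in> mixed_words 3")
    case True
    \<comment> \<open>Unfolded for a variable word, so that the membership test of the definition is discharged
      by the assumption before the letters are known.\<close>
    then have unfold: "mixed_hochschild S 2 \<alpha> \<beta> ws =
        mixed_act S (hd ws) (mixed_apply \<alpha> \<beta> (tl ws))
        + (\<Sum>i=1..2. alt_sign i (\<beta> (contract (mixed_mul S) i ws)))
        + alt_sign 3 (mixed_act S (mixed_apply \<alpha> \<beta> (butlast ws)) (last ws))"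
      by (simp add: mixed_hochschild_def)
    from True show ?thesis
    proof (cases rule: mixed_words_3_cases)
      case (left a b u)
      then show ?thesis
        unfolding unfold using first_order(2)[of a b u] by (simp add: eval algebra_simps)
    next
      case (middle a u b)
      then show ?thesis
        unfolding unfold using first_order(4)[of a u b] by (simp add: eval algebra_simps)
    next
      case (right u a b)
      then show ?thesis
        unfolding unfold using first_order(3)[of u a b] by (simp add: eval algebra_simps)
    qed
  qed (simp add: mixed_hochschild_def)
  moreover have "rb_diff S 1 \<gamma> xs us + rb_h S 2 \<alpha> \<beta> xs us = 0" for xs us
  proof (cases "length xs = 2 \<and> length us = 2")
    case True
    then obtain x y u v where "xs = [x, y]" "us = [u, v]"
      by (auto simp: length_Suc_conv numeral_2_eq_2)
    then show ?thesis
      using first_order(5)[of x u y v]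
      by (simp add: rb_diff_def rb_h_def eval algebra_simps)
  qed (auto simp: rb_diff_def rb_h_def)
  ultimately have "mrrb_diff S 2 (infinitesimal D) = 0"
    by (auto simp: inf zero_prod_def fun_eq_iff)
  then show ?thesis
    using infinitesimal_in_cochains[OF D] by (simp add: mrrb_cocycles_def)
qed

section \<open>Equivalent deformations\<close>

text \<open>
  The first-order part of an equivalence, as a 1-cochain. The third component is \<open>0\<close> since the
  complex has no Rota-Baxter part in degree one.
\<close>

definition linear_pair_cochain ::
  "('a::ab_group_add \<Rightarrow> 'a) \<Rightarrow> ('m::ab_group_add \<Rightarrow> 'm) \<Rightarrow> ('a, 'm, 'x) cochain" where
  "linear_pair_cochain f g =
     ((\<lambda>as. case as of [a] \<Rightarrow> f a | _ \<Rightarrow> 0), (\<lambda>ws. case ws of [Inr u] \<Rightarrow> g u | _ \<Rightarrow> 0), 0)"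

lemma mixed_words_1: "ws \<in> mixed_words 1 \<longleftrightarrow> (\<exists>u. ws = [Inr u])"
proof
  assume "ws \<in> mixed_words 1"
  then obtain w where "ws = [w]" and "\<not> isl w"
    by (auto simp: mixed_words_def length_Suc_conv split: if_splits)
  then show "\<exists>u. ws = [Inr u]" by (cases w) auto
qed (auto simp: mixed_words_def)

lemma linear_pair_cochain_in_cochains:
  assumes "module_hom sA sA f" "module_hom sM sM g"
  shows "linear_pair_cochain f g \<in> mrrb_cochains sA sM 1"
  using assms
  by (auto simp: linear_pair_cochain_def mrrb_cochains_def multilinear_maps_def mixed_maps_def
        mixed_words_1[simplified] append_eq_Cons_conv split: list.split sum.split)

text \<open>
  The coefficient of \<open>t\<close> in the morphism equations, read off on constant series. Since
  \<open>\<phi> 0\<close> and \<open>\<psi> 0\<close> are identities, the two first-order structures enter without any twist.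
\<close>

lemma first_order_equivalence:
  assumes D: "formal_deformation sA sM S D" and D': "formal_deformation sA sM S D'"
    and id: "\<phi> 0 = id" "\<psi> 0 = id"
    and mor: "mrrb_morphism (fps_scale sA) (fps_scale sM) (fps_ops D)
          (fps_scale sA) (fps_scale sM) (fps_ops D') (fps_linear_ext \<phi>) (fps_linear_ext \<psi>)"
  shows "mul (D 1) a b + \<phi> 1 (mul S a b) =
           mul S a (\<phi> 1 b) + mul S (\<phi> 1 a) b + mul (D' 1) a b" (is ?mul)
    and "lact (D 1) a u + \<psi> 1 (lact S a u) =
           lact S a (\<psi> 1 u) + lact S (\<phi> 1 a) u + lact (D' 1) a u" (is ?lact)
    and "ract (D 1) u a + \<psi> 1 (ract S u a) =
           ract S u (\<phi> 1 a) + ract S (\<psi> 1 u) a + ract (D' 1) u a" (is ?ract)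
    and "rb (D 1) x u + \<phi> 1 (rb S x u) = rb S x (\<psi> 1 u) + rb (D' 1) x u" (is ?rb)
proof -
  note D0 = formal_deformationD(1)[OF D] formal_deformationD(1)[OF D']
  note low = D0 id nth_low fps_ops_simps
    module_bilinear_zero[OF formal_deformationD(2)[OF D, of 0, unfolded D0]]
    module_bilinear_zero[OF formal_deformationD(3)[OF D, of 0, unfolded D0]]
    module_bilinear_zero[OF formal_deformationD(4)[OF D, of 0, unfolded D0]]
    module_hom.zero[OF formal_deformationD(5)[OF D, of 0, unfolded D0]]
  let ?\<phi> = "fps_linear_ext \<phi>" and ?\<psi> = "fps_linear_ext \<psi>"
  have eqs:
    "?\<phi> (mul (fps_ops D) f g) = mul (fps_ops D') (?\<phi> f) (?\<phi> g)"
    "?\<psi> (lact (fps_ops D) f h) = lact (fps_ops D') (?\<phi> f) (?\<psi> h)"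
    "?\<psi> (ract (fps_ops D) h f) = ract (fps_ops D') (?\<psi> h) (?\<phi> f)"
    "?\<phi> (rb (fps_ops D) x h) = rb (fps_ops D') x (?\<psi> h)" for f g h x
    using mor unfolding mrrb_morphism_def by blast+
  show ?mul
    using arg_cong[OF eqs(1)[of "fps_const a" "fps_const b"], of "\<lambda>f. fps_nth f 1"]
    by (simp add: low)
  show ?lact
    using arg_cong[OF eqs(2)[of "fps_const a" "fps_const u"], of "\<lambda>f. fps_nth f 1"]
    by (simp add: low)
  show ?ract
    using arg_cong[OF eqs(3)[of "fps_const u" "fps_const a"], of "\<lambda>f. fps_nth f 1"]
    by (simp add: low)
  show ?rb
    using arg_cong[OF eqs(4)[of x "fps_const u"], of "\<lambda>f. fps_nth f 1"]
    by (simp add: low)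
qed

text \<open>
  The first-order morphism equations are the three components of this identity. In the last one
  the sign \<open>(-1)\<^sup>1\<close> of \<^const>\<open>rb_h\<close> in degree one turns \<open>\<phi>\<^sub>1 \<circ> P - P \<circ> \<psi>\<^sub>1\<close> into the required
  \<open>P\<^sub>1 - P'\<^sub>1\<close>.
\<close>

lemma infinitesimal_diff_coboundary:
  fixes S :: "('a::ab_group_add, 'm::ab_group_add, 'x) mrrb_ops"
  assumes D: "formal_deformation sA sM S D" and D': "formal_deformation sA sM S D'"
    and id: "\<phi> 0 = id" "\<psi> 0 = id"
    and mor: "mrrb_morphism (fps_scale sA) (fps_scale sM) (fps_ops D)
          (fps_scale sA) (fps_scale sM) (fps_ops D') (fps_linear_ext \<phi>) (fps_linear_ext \<psi>)"
  shows "infinitesimal D - infinitesimal D' = mrrb_diff S 1 (linear_pair_cochain (\<phi> 1) (\<psi> 1))"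
proof -
  obtain \<alpha> \<beta> where lp:
      "linear_pair_cochain (\<phi> 1) (\<psi> 1) = (\<alpha>, \<beta>, 0 :: 'x list \<Rightarrow> 'm list \<Rightarrow> 'a)"
    by (simp add: linear_pair_cochain_def)
  obtain \<alpha>1 \<beta>1 \<gamma>1 where inf1: "infinitesimal D = (\<alpha>1, \<beta>1, \<gamma>1)"
    and \<alpha>1: "\<And>a b. \<alpha>1 [a, b] = mul (D 1) a b" "\<And>as. length as \<noteq> 2 \<Longrightarrow> \<alpha>1 as = 0"
    and \<beta>1: "\<And>a u. \<beta>1 [Inl a, Inr u] = lact (D 1) a u"
      "\<And>u a. \<beta>1 [Inr u, Inl a] = ract (D 1) u a" "\<And>ws. ws \<notin> mixed_words 2 \<Longrightarrow> \<beta>1 ws = 0"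
    and \<gamma>1: "\<And>x u. \<gamma>1 [x] [u] = rb (D 1) x u" "\<And>xs. length xs \<noteq> 1 \<Longrightarrow> \<gamma>1 xs = 0"
      "\<And>xs us. length us \<noteq> 1 \<Longrightarrow> \<gamma>1 xs us = 0"
    by (rule infinitesimal_components[of D]) blast
  obtain \<alpha>2 \<beta>2 \<gamma>2 where inf2: "infinitesimal D' = (\<alpha>2, \<beta>2, \<gamma>2)"
    and \<alpha>2: "\<And>a b. \<alpha>2 [a, b] = mul (D' 1) a b" "\<And>as. length as \<noteq> 2 \<Longrightarrow> \<alpha>2 as = 0"
    and \<beta>2: "\<And>a u. \<beta>2 [Inl a, Inr u] = lact (D' 1) a u"
      "\<And>u a. \<beta>2 [Inr u, Inl a] = ract (D' 1) u a" "\<And>ws. ws \<notin> mixed_words 2 \<Longrightarrow> \<beta>2 ws = 0"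
    and \<gamma>2: "\<And>x u. \<gamma>2 [x] [u] = rb (D' 1) x u" "\<And>xs. length xs \<noteq> 1 \<Longrightarrow> \<gamma>2 xs = 0"
      "\<And>xs us. length us \<noteq> 1 \<Longrightarrow> \<gamma>2 xs us = 0"
    by (rule infinitesimal_components[of D']) blast
  have \<alpha>: "\<alpha> [a] = \<phi> 1 a" for a
    using lp by (auto simp: linear_pair_cochain_def)
  have \<beta>: "\<beta> [Inr u] = \<psi> 1 u" for u
    using lp by (auto simp: linear_pair_cochain_def)
  note eval = contract_def alt_sign_eval \<alpha> \<beta> mixed_apply_def
  note first_order = first_order_equivalence[OF D D' id mor, simplified]
  have "\<alpha>1 as - \<alpha>2 as = hochschild (mul S) 1 \<alpha> as" for as
  proof (cases "length as = 2")
    case True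
    then obtain a b where "as = [a, b]"
      by (auto simp: length_Suc_conv numeral_2_eq_2)
    then show ?thesis
      using first_order(1)[of a b] by (simp add: hochschild_def eval \<alpha>1 \<alpha>2 algebra_simps)
  qed (simp add: hochschild_def \<alpha>1 \<alpha>2)
  moreover have "\<beta>1 ws - \<beta>2 ws = mixed_hochschild S 1 \<alpha> \<beta> ws" for ws
  proof (cases "ws \<in> mixed_words 2")
    case True
    \<comment> \<open>Unfolded for a variable word, so that the membership test of the definition is discharged
      by the assumption before the letters are known.\<close>
    then have unfold: "mixed_hochschild S 1 \<alpha> \<beta> ws =
        mixed_act S (hd ws) (mixed_apply \<alpha> \<beta> (tl ws))
        + (\<Sum>i=1..1. alt_sign i (\<beta> (contract (mixed_mul S) i ws)))
        + alt_sign 2 (mixed_act S (mixed_apply \<alpha> \<beta> (butlast ws)) (last ws))"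
      by (simp add: mixed_hochschild_def numeral_2_eq_2)
    from True consider a u where "ws = [Inl a, Inr u]" | u a where "ws = [Inr u, Inl a]"
      by (auto simp: mixed_words_2)
    then show ?thesis
    proof cases
      case (1 a u)
      then show ?thesis
        unfolding unfold using first_order(2)[of a u] by (simp add: eval \<beta>1 \<beta>2 algebra_simps)
    next
      case (2 u a)
      then show ?thesis
        unfolding unfold using first_order(3)[of u a] by (simp add: eval \<beta>1 \<beta>2 algebra_simps)
    qed
  qed (simp add: mixed_hochschild_def \<beta>1 \<beta>2 numeral_2_eq_2)
  moreover have "\<gamma>1 xs us - \<gamma>2 xs us = rb_h S 1 \<alpha> \<beta> xs us" for xs us
  proof (cases "length xs = 1 \<and> length us = 1")
    case True
    then obtain x u where "xs = [x]" "us = [u]"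
      by (auto simp: length_Suc_conv)
    then show ?thesis
      using first_order(4)[of x u] by (simp add: rb_h_def eval \<gamma>1 \<gamma>2 algebra_simps)
  qed (auto simp: rb_h_def \<gamma>1 \<gamma>2)
  ultimately show ?thesis
    by (simp add: lp[simplified] inf1 inf2 fun_eq_iff)
qed

theorem theorem5p3:
  fixes sA :: "'k::comm_ring_1 \<Rightarrow> 'a::ab_group_add \<Rightarrow> 'a"
    and sM :: "'k \<Rightarrow> 'm::ab_group_add \<Rightarrow> 'm"
    and S :: "('a, 'm, 'x) mrrb_ops"
  assumes "CHAR('k) \<noteq> 2"
    and "matching_rel_RB_algebra sA sM S"
  shows "(\<forall>D. formal_deformation sA sM S D \<longrightarrow>
            infinitesimal D \<in> mrrb_cocycles sA sM S 2 \<and>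
            cohomology_class sA sM S 2 (infinitesimal D) \<in> mrrb_cohomology sA sM S 2) \<and>
         (\<forall>D D'. formal_deformation sA sM S D \<longrightarrow> formal_deformation sA sM S D' \<longrightarrow>
            equivalent_deformations sA sM D D' \<longrightarrow>
            cohomology_class sA sM S 2 (infinitesimal D) =
            cohomology_class sA sM S 2 (infinitesimal D'))"
proof (intro conjI allI impI)
  fix D assume "formal_deformation sA sM S D"
  then show cocycle: "infinitesimal D \<in> mrrb_cocycles sA sM S 2"
    by (rule infinitesimal_cocycle)
  show "cohomology_class sA sM S 2 (infinitesimal D) \<in> mrrb_cohomology sA sM S 2"
    unfolding cohomology_class_def mrrb_cohomology_def by (rule quotientI[OF cocycle])
next
  fix D D'
  assume D: "formal_deformation sA sM S D" and D': "formal_deformation sA sM S D'"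
    and "equivalent_deformations sA sM D D'"
  then obtain \<phi> \<psi> where id: "\<phi> 0 = id" "\<psi> 0 = id"
    and hom: "module_hom sA sA (\<phi> 1)" "module_hom sM sM (\<psi> 1)"
    and mor: "mrrb_morphism (fps_scale sA) (fps_scale sM) (fps_ops D)
          (fps_scale sA) (fps_scale sM) (fps_ops D') (fps_linear_ext \<phi>) (fps_linear_ext \<psi>)"
    unfolding equivalent_deformations_def by blast
  have "linear_pair_cochain (\<phi> 1) (\<psi> 1) \<in> (mrrb_cochains sA sM 1 :: ('a, 'm, 'x) cochain set)"
    by (rule linear_pair_cochain_in_cochains[OF hom])
  then have "infinitesimal D - infinitesimal D' \<in> mrrb_coboundaries sA sM S 2"
    using infinitesimal_diff_coboundary[OF D D' id mor] by (simp add: mrrb_coboundaries_def)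
  then have "(infinitesimal D, infinitesimal D') \<in> cohomologous sA sM S 2"
    using infinitesimal_cocycle[OF D] infinitesimal_cocycle[OF D']
    by (simp add: cohomologous_def)
  then show "cohomology_class sA sM S 2 (infinitesimal D) =
      cohomology_class sA sM S 2 (infinitesimal D')"
    unfolding cohomology_class_def by (rule equiv_class_eq[OF equiv_cohomologous[OF assms(2)]])
qed

end
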